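(* Let $\{(X_i,a_i)\}_{i\ge0}$ be a controlled Markov chain on $\chi\times\mathbb I$. For any (measurable) $S\subseteq\chi\times\mathbb I$ and any $n$, $$\nu_n(S)\ge\frac1{T(S)}-\frac1n$$ (with $1/\infty=0$).
   Context: The process $\{(X_i,a_i)\}_{i\ge0}$ is defined on a filtered probability space $(\Omega,\mathcal F,\{\mathcal F_i\}_{i\ge0},\mathbb P)$, adapted, with states $X_i\in\chi\subset\mathbb R^{d_1}$ and controls $a_i\in\mathbb I\subset\mathbb R^{d_2}$; it is a controlled Markov chain if, for some transition function $s$ and reference measure $\mu_\chi$ on $\chi$, $\mathbb P(X_{i+1}\in dy\mid X_0,a_0,\dots,X_i,a_i)=s(X_i,a_i,y)\mu_\chi(dy)$ for all $i$. $\nu_n(S)=\frac1n\sum_{i=1}^n\mathbb P((X_i,a_i)\in S)$. Return times: $\tau_S^{(0)}=0$; $\tau_S^{(1)}=\min\{n\ge0:(X_n,a_n)\in S\}$ is the first hitting time; for $i\ge2$, the $i$-th return time $\tau_S^{(i)}$ is the smallest $n\ge1$ with $(X_{\sigma+n},a_{\sigma+n})\in S$, where $\sigma=\sum_{k=1}^{i-1}\tau_S^{(k)}$ is the time of the $(i-1)$-th visit to $S$. The maximum expected return time is $T(S)=\sup_{i\ge1}\mathbb E\big[\tau_S^{(i)}\mid\mathcal F_{\sum_{p=0}^{i-1}\tau_S^{(p)}}\big]\in[0,\infty]$, where the supremum is essential, i.e. $T(S)$ is the smallest constant bounding all these conditional expectations almost surely. *)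

theory Defs
  imports "HOL-Probability.Probability"
begin

text \<open>The \<open>\<sigma>\<close>-algebra generated by \<open>(X\<^sub>0, a\<^sub>0), \<dots>, (X\<^sub>i, a\<^sub>i)\<close>.\<close>

definition history ::
  "'w measure \<Rightarrow> 'x measure \<Rightarrow> 'c measure \<Rightarrow> (nat \<Rightarrow> 'w \<Rightarrow> 'x) \<Rightarrow> (nat \<Rightarrow> 'w \<Rightarrow> 'c) \<Rightarrow> nat \<Rightarrow> 'w measure"
where
  "history M MX MI X a i =
     vimage_algebra (space M) (\<lambda>\<omega>. \<lambda>j\<in>{..i}. (X j \<omega>, a j \<omega>)) (\<Pi>\<^sub>M j\<in>{..i}. MX \<Otimes>\<^sub>M MI)"

text \<open>
  The state space \<open>\<X>\<close> and the control space \<open>\<I>\<close> carry the traces of the Borel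
  \<open>\<sigma>\<close>-algebras. The measures \<open>F i\<close> only matter as \<open>\<sigma>\<close>-algebras. The Markov property states
  \<open>P(X\<^sub>i\<^sub>+\<^sub>1 \<in> B | X\<^sub>0, a\<^sub>0, \<dots>, X\<^sub>i, a\<^sub>i) = \<integral>\<^sub>B s(X\<^sub>i, a\<^sub>i, y) \<mu>(dy)\<close> almost surely, for every \<open>B\<close>.
\<close>

locale controlled_markov_chain = prob_space M + filtration "space M" F
  for M :: "'w measure" and F :: "nat \<Rightarrow> 'w measure" +
  fixes \<X> :: "(real ^ 'd1) set" and \<I> :: "(real ^ 'd2) set"
    and X :: "nat \<Rightarrow> 'w \<Rightarrow> real ^ 'd1" and a :: "nat \<Rightarrow> 'w \<Rightarrow> real ^ 'd2"
  assumes sets_F: "\<And>i. sets (F i) \<subseteq> sets M"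
    and adapted_X: "\<And>i. X i \<in> F i \<rightarrow>\<^sub>M restrict_space borel \<X>"
    and adapted_a: "\<And>i. a i \<in> F i \<rightarrow>\<^sub>M restrict_space borel \<I>"
    and markov:
      "\<exists>(s :: real ^ 'd1 \<Rightarrow> real ^ 'd2 \<Rightarrow> real ^ 'd1 \<Rightarrow> real) (\<mu> :: (real ^ 'd1) measure).
         sets \<mu> = sets (restrict_space borel \<X>) \<and>
         (\<lambda>((x, c), y). s x c y)
           \<in> borel_measurable ((restrict_space borel \<X> \<Otimes>\<^sub>M restrict_space borel \<I>) \<Otimes>\<^sub>M \<mu>) \<and>
         (\<forall>x\<in>\<X>. \<forall>c\<in>\<I>. \<forall>y\<in>\<X>. 0 \<le> s x c y) \<and>
         (\<forall>i. \<forall>B\<in>sets (restrict_space borel \<X>). AE \<omega> in M.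
            nn_cond_exp M (history M (restrict_space borel \<X>) (restrict_space borel \<I>) X a i)
              (\<lambda>\<omega>. indicator B (X (Suc i) \<omega>)) \<omega>
            = (\<integral>\<^sup>+ y\<in>B. ennreal (s (X i \<omega>) (a i \<omega>) y) \<partial>\<mu>))"

definition occupation_freq ::
  "'w measure \<Rightarrow> (nat \<Rightarrow> 'w \<Rightarrow> 'x) \<Rightarrow> (nat \<Rightarrow> 'w \<Rightarrow> 'c) \<Rightarrow> nat \<Rightarrow> ('x \<times> 'c) set \<Rightarrow> real"
where
  "occupation_freq M X a n S =
     1 / real n * (\<Sum>i = 1..n. measure M {\<omega> \<in> space M. (X i \<omega>, a i \<omega>) \<in> S})"

text \<open>
  A visit that never happens has return time \<open>\<infinity> = Inf {}\<close>; this also covers the case that an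
  earlier visit never happens, where no \<open>m\<close> satisfies the equation with \<open>enat m\<close>.
\<close>

fun return_time ::
  "(nat \<Rightarrow> 'w \<Rightarrow> 'x) \<Rightarrow> (nat \<Rightarrow> 'w \<Rightarrow> 'c) \<Rightarrow> ('x \<times> 'c) set \<Rightarrow> nat \<Rightarrow> 'w \<Rightarrow> enat"
where
  "return_time X a S 0 \<omega> = 0"
| "return_time X a S (Suc 0) \<omega> = Inf {enat n | n. (X n \<omega>, a n \<omega>) \<in> S}"
| "return_time X a S (Suc (Suc i)) \<omega> =
     Inf {enat n | m n. (\<Sum>k = 1..Suc i. return_time X a S k \<omega>) = enat m \<and>
                        1 \<le> n \<and> (X (m + n) \<omega>, a (m + n) \<omega>) \<in> S}"

definition visit_time ::
  "(nat \<Rightarrow> 'w \<Rightarrow> 'x) \<Rightarrow> (nat \<Rightarrow> 'w \<Rightarrow> 'c) \<Rightarrow> ('x \<times> 'c) set \<Rightarrow> nat \<Rightarrow> 'w \<Rightarrow> enat"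
where
  "visit_time X a S i \<omega> = (\<Sum>p = 0..i. return_time X a S p \<omega>)"

text \<open>
  Visit times may be infinite, so the filtration is extended by
  \<open>\<F>\<^sub>\<infinity> = \<sigma>(\<Union>n. \<F>\<^sub>n)\<close> before forming stopped \<open>\<sigma>\<close>-algebras.
\<close>

definition extend_filtration :: "'w measure \<Rightarrow> (nat \<Rightarrow> 'w measure) \<Rightarrow> enat \<Rightarrow> 'w measure" where
  "extend_filtration M F t =
     (case t of enat n \<Rightarrow> F n | \<infinity> \<Rightarrow> sigma (space M) (\<Union>n. sets (F n)))"

definition stopped_algebra ::
  "'w measure \<Rightarrow> (nat \<Rightarrow> 'w measure) \<Rightarrow> ('w \<Rightarrow> enat) \<Rightarrow> 'w measure"
where
  "stopped_algebra M F \<sigma> = filtration.pre_sigma (space M) (extend_filtration M F) \<sigma>"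

definition cond_return_time ::
  "'w measure \<Rightarrow> (nat \<Rightarrow> 'w measure) \<Rightarrow> (nat \<Rightarrow> 'w \<Rightarrow> 'x) \<Rightarrow> (nat \<Rightarrow> 'w \<Rightarrow> 'c) \<Rightarrow> ('x \<times> 'c) set
     \<Rightarrow> nat \<Rightarrow> 'w \<Rightarrow> ennreal"
where
  "cond_return_time M F X a S i =
     nn_cond_exp M (stopped_algebra M F (visit_time X a S (i - 1)))
       (\<lambda>\<omega>. ennreal_of_enat (return_time X a S i \<omega>))"

definition max_return_time ::
  "'w measure \<Rightarrow> (nat \<Rightarrow> 'w measure) \<Rightarrow> (nat \<Rightarrow> 'w \<Rightarrow> 'x) \<Rightarrow> (nat \<Rightarrow> 'w \<Rightarrow> 'c) \<Rightarrow> ('x \<times> 'c) set \<Rightarrow> ennreal"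
where
  "max_return_time M F X a S = esssup M (\<lambda>\<omega>. SUP i\<in>{1..}. cond_return_time M F X a S i \<omega>)"

lemma max_return_time_le_iff:
  "max_return_time M F X a S \<le> c \<longleftrightarrow> (\<forall>i\<ge>1. AE \<omega> in M. cond_return_time M F X a S i \<omega> \<le> c)"
proof -
  have [measurable]: "cond_return_time M F X a S i \<in> borel_measurable M" for i
    unfolding cond_return_time_def by (rule borel_measurable_nn_cond_exp2)
  let ?f = "\<lambda>\<omega>. SUP i\<in>{1..}. cond_return_time M F X a S i \<omega>"
  have "max_return_time M F X a S \<le> c \<longleftrightarrow> (AE \<omega> in M. ?f \<omega> \<le> c)"
  proof
    assume "max_return_time M F X a S \<le> c"
    moreover have "AE \<omega> in M. ?f \<omega> \<le> esssup M ?f" by (rule esssup_AE)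
    ultimately show "AE \<omega> in M. ?f \<omega> \<le> c"
      unfolding max_return_time_def by (auto elim: order_trans)
  next
    assume "AE \<omega> in M. ?f \<omega> \<le> c"
    then show "max_return_time M F X a S \<le> c"
      unfolding max_return_time_def by (intro esssup_I) auto
  qed
  also have "\<dots> \<longleftrightarrow> (AE \<omega> in M. \<forall>i\<in>{1..}. cond_return_time M F X a S i \<omega> \<le> c)"
    by (simp only: SUP_le_iff)
  also have "\<dots> \<longleftrightarrow> (\<forall>i\<in>{1..}. AE \<omega> in M. cond_return_time M F X a S i \<omega> \<le> c)"
    by (rule AE_ball_countable) auto
  finally show ?thesis by auto
qed

text \<open>
  \<open>nn_cond_exp\<close> is \<open>0\<close> outside its intended domain. For a controlled Markov chain and measurable
  \<open>S\<close> every conditional expectation above is a genuine one.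
\<close>

context controlled_markov_chain
begin

lemma sets_F_closed: "(\<Union>n. sets (F n)) \<subseteq> Pow (space M)"
  using sets.sets_into_space sets_F by blast

lemma space_extend_filtration: "space (extend_filtration M F t) = space M"
  by (cases t) (simp_all add: extend_filtration_def space_F space_measure_of[OF sets_F_closed])

lemma sets_extend_filtration_infinity:
  "sets (extend_filtration M F \<infinity>) = sigma_sets (space M) (\<Union>n. sets (F n))"
  by (simp add: extend_filtration_def sets_measure_of[OF sets_F_closed])

lemma filtration_extend: "filtration (space M) (extend_filtration M F)"
proof
  fix t u :: enat assume le: "t \<le> u"
  show "sets (extend_filtration M F t) \<subseteq> sets (extend_filtration M F u)"
  proof (cases u)
    case (enat n)
    with le obtain m where "t = enat m" "m \<le> n" by (cases t) auto
    with enat show ?thesis using sets_F_mono by (auto simp: extend_filtration_def)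
  next
    case infinity
    show ?thesis
    proof (cases t)
      case (enat m)
      then have "sets (extend_filtration M F t) = sets (F m)"
        by (simp add: extend_filtration_def)
      then show ?thesis
        using infinity by (auto simp: sets_extend_filtration_infinity)
    qed (use infinity in simp)
  qed
qed (rule space_extend_filtration)

lemma subalgebra_stopped_algebra: "subalgebra M (stopped_algebra M F \<sigma>)"
proof -
  interpret E: filtration "space M" "extend_filtration M F" by (rule filtration_extend)
  have "sets (extend_filtration M F \<infinity>) \<subseteq> sets M"
    unfolding sets_extend_filtration_infinity
    by (rule sets.sigma_sets_subset) (use sets_F in auto)
  moreover have "A \<in> sets (extend_filtration M F \<infinity>)"
    if "\<forall>t. {\<omega> \<in> A. \<sigma> \<omega> \<le> t} \<in> sets (extend_filtration M F t)" for A
    using that[rule_format, of \<infinity>] by simp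
  ultimately have *: "{A. \<forall>t. {\<omega> \<in> A. \<sigma> \<omega> \<le> t} \<in> sets (extend_filtration M F t)} \<subseteq> sets M"
    by blast
  have "sets (E.pre_sigma \<sigma>) \<subseteq> sets M"
    unfolding E.pre_sigma_def sets_measure_of[OF order_trans[OF * sets.space_closed]]
    by (rule sets.sigma_sets_subset[OF *])
  then show ?thesis
    by (simp add: subalgebra_def stopped_algebra_def E.space_pre_sigma)
qed

lemma measurable_pair:
  "(\<lambda>\<omega>. (X i \<omega>, a i \<omega>)) \<in> M \<rightarrow>\<^sub>M restrict_space borel \<X> \<Otimes>\<^sub>M restrict_space borel \<I>"
proof -
  have sub: "subalgebra M (F i)"
    using sets_F space_F by (simp add: subalgebra_def)
  show ?thesis
    using measurable_from_subalg[OF sub adapted_X] measurable_from_subalg[OF sub adapted_a]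
    by (rule measurable_Pair)
qed

lemma subalgebra_history:
  "subalgebra M (history M (restrict_space borel \<X>) (restrict_space borel \<I>) X a i)"
proof -
  have "(\<lambda>\<omega>. \<lambda>j\<in>{..i}. (X j \<omega>, a j \<omega>))
          \<in> M \<rightarrow>\<^sub>M (\<Pi>\<^sub>M j\<in>{..i}. restrict_space borel \<X> \<Otimes>\<^sub>M restrict_space borel \<I>)"
    by (rule measurable_restrict) (rule measurable_pair)
  then show ?thesis
    unfolding history_def subalgebra_def
    by (simp add: sets_image_in_sets)
qed

lemma measurable_return_time:
  assumes S: "S \<in> sets (restrict_space borel \<X> \<Otimes>\<^sub>M restrict_space borel \<I>)"
  shows "(\<lambda>\<omega>. ennreal_of_enat (return_time X a S i \<omega>)) \<in> borel_measurable M"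
proof -
  have [measurable]: "Measurable.pred M (\<lambda>\<omega>. (X n \<omega>, a n \<omega>) \<in> S)" for n
    using measurable_pair S by (rule pred_sets2[rotated])
  have first: "(\<lambda>\<omega>. Inf {enat n | n. P n \<omega>}) \<in> borel_measurable M"
    if [measurable]: "\<And>n. Measurable.pred M (P n)" for P :: "nat \<Rightarrow> 'w \<Rightarrow> bool"
  proof -
    have "Inf {enat n | n. P n \<omega>} = (INF n. if P n \<omega> then enat n else \<infinity>)" for \<omega>
    proof (rule antisym)
      show "Inf {enat n | n. P n \<omega>} \<le> (INF n. if P n \<omega> then enat n else \<infinity>)"
        by (rule INF_greatest) (simp, blast intro: Inf_lower)
      show "(INF n. if P n \<omega> then enat n else \<infinity>) \<le> Inf {enat n | n. P n \<omega>}"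
      proof (rule Inf_greatest)
        fix x assume "x \<in> {enat n | n. P n \<omega>}"
        then obtain n where "x = enat n" "P n \<omega>" by blast
        then show "(INF n. if P n \<omega> then enat n else \<infinity>) \<le> x"
          by (intro INF_lower2[of n]) simp_all
      qed
    qed
    moreover have "(\<lambda>\<omega>. INF n. if P n \<omega> then enat n else \<infinity>) \<in> borel_measurable M"
      by (intro borel_measurable_INF measurable_If) auto
    ultimately show ?thesis by presburger
  qed
  have "return_time X a S i \<in> borel_measurable M"
  proof (induction i rule: less_induct)
    case (less i)
    consider "i = 0" | "i = Suc 0" | j where "i = Suc (Suc j)"
      by (metis not0_implies_Suc)
    then show ?case
    proof cases
      case 1
      then have "return_time X a S i = (\<lambda>\<omega>. 0)" by auto
      then show ?thesis by simp
    next
      case 2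
      then have "return_time X a S i = (\<lambda>\<omega>. Inf {enat n | n. (X n \<omega>, a n \<omega>) \<in> S})" by auto
      then show ?thesis using first[of "\<lambda>n \<omega>. (X n \<omega>, a n \<omega>) \<in> S"] by simp
    next
      case 3
      have [measurable]: "(\<lambda>\<omega>. \<Sum>k = 1..Suc j. return_time X a S k \<omega>) \<in> borel_measurable M"
        using less 3 by (intro borel_measurable_sum) auto
      have "return_time X a S i = (\<lambda>\<omega>. Inf {enat n | n. \<exists>m. (\<Sum>k = 1..Suc j. return_time X a S k \<omega>) = enat m \<and>
          1 \<le> n \<and> (X (m + n) \<omega>, a (m + n) \<omega>) \<in> S})"
        unfolding 3 return_time.simps by (intro ext arg_cong[where f = Inf]) blast
      then show ?thesis by (simp only:) (rule first, measurable)
    qed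
  qed
  then have "return_time X a S i \<in> M \<rightarrow>\<^sub>M count_space UNIV"
    by (simp add: measurable_count_space_eq2_countable borel_measurable_vimage)
  then show ?thesis by (rule measurable_compose) simp
qed

end

end

theory Submission
  imports Defs
begin

text \<open>
  The proof is Wald's inequality. Let \<open>V\<^sub>i\<close> be the time of the \<open>i\<close>-th visit and \<open>N\<close> the number of
  visits up to time \<open>n\<close>, so that \<open>n < V\<^bsub>N+1\<^esub> = \<Sum>\<^sub>i \<tau>\<^sup>(\<^sup>i\<^sup>+\<^sup>1\<^sup>) \<cdot> 1\<^bsub>A\<^sub>i\<^esub>\<close> for the events
  \<open>A\<^sub>i = {V\<^sub>i \<le> n}\<close>. Since \<open>V\<^sub>i\<close> is a stopping time, \<open>A\<^sub>i\<close> belongs to the \<open>\<sigma>\<close>-algebra stopped at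
  \<open>V\<^sub>i\<close>, and every summand has expectation at most \<open>T(S) P(A\<^sub>i)\<close>. The sum is unchanged if \<open>A\<^sub>0\<close> is
  replaced by \<open>{(X\<^sub>0, a\<^sub>0) \<notin> S}\<close>, because \<open>\<tau>\<^sup>(\<^sup>1\<^sup>) = 0\<close> off that event; then
  \<open>\<Sum>\<^sub>i 1\<^bsub>A\<^sub>i\<^esub>\<close> is one more than the number of visits during \<open>{1..n}\<close>, and
  \<open>n \<le> T(S) (1 + n \<nu>\<^sub>n(S))\<close> follows.
\<close>

section \<open>Visit times as counts of hits\<close>

text \<open>By well-ordering a nonempty infimum is attained, and a finite bound rules out
  \<open>Inf {} = \<infinity>\<close>.\<close>

lemma Inf_enat_le_iff: "Inf A \<le> enat t \<longleftrightarrow> (\<exists>x\<in>A. x \<le> enat t)"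
proof
  assume le: "Inf A \<le> enat t"
  then have "A \<noteq> {}" by (auto simp: Inf_enat_def)
  then have "Inf A \<in> A" using wellorder_InfI by blast
  with le show "\<exists>x\<in>A. x \<le> enat t" by blast
qed (meson Inf_lower order_trans)

lemma return_time_1_eq_0_iff: "return_time X a S (Suc 0) \<omega> = 0 \<longleftrightarrow> (X 0 \<omega>, a 0 \<omega>) \<in> S"
proof -
  have "return_time X a S (Suc 0) \<omega> \<le> enat 0 \<longleftrightarrow> (X 0 \<omega>, a 0 \<omega>) \<in> S"
    unfolding return_time.simps Inf_enat_le_iff by auto
  then show ?thesis by (simp add: zero_enat_def[symmetric] del: return_time.simps)
qed

lemma visit_time_0 [simp]: "visit_time X a S 0 \<omega> = 0"
  by (simp add: visit_time_def)

lemma visit_time_Suc: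
  "visit_time X a S (Suc i) \<omega> = visit_time X a S i \<omega> + return_time X a S (Suc i) \<omega>"
  by (simp add: visit_time_def)

lemma visit_time_conv_sum:
  "(\<Sum>k = 1..Suc i. return_time X a S k \<omega>) = visit_time X a S (Suc i) \<omega>"
  unfolding visit_time_def by (subst (2) sum.atLeast_Suc_atMost) auto

lemma visit_time_eq_sum:
  "visit_time X a S i \<omega> = (\<Sum>k<i. return_time X a S (Suc k) \<omega>)"
  by (induction i) (simp_all add: visit_time_Suc)

text \<open>Replaces the recursion for visit times by a count of hits in \<open>{0..t}\<close>, on
  which the pathwise and measurability arguments rest. \<open>t\<close> stays arbitrary because the
  step also uses the hypothesis at the \<open>i\<close>-th visit time and just before it.\<close>

lemma visit_time_le_iff:
  "visit_time X a S i \<omega> \<le> enat t \<longleftrightarrow> i \<le> card {s. s \<le> t \<and> (X s \<omega>, a s \<omega>) \<in> S}"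
proof (induction i arbitrary: t)
  case 0
  then show ?case by simp
next
  case (Suc i)
  let ?P = "\<lambda>s. (X s \<omega>, a s \<omega>) \<in> S"
  let ?C = "\<lambda>t. {s. s \<le> t \<and> ?P s}"
  show ?case
  \<comment> \<open>The first hit may occur at time 0, while later returns need
    \<open>1 \<le> n\<close>.\<close>
  proof (cases i)
    case 0
    have "Suc 0 \<le> card (?C t) \<longleftrightarrow> ?C t \<noteq> {}"
      by (simp add: Suc_le_eq card_gt_0_iff)
    then show ?thesis
      using 0 by (auto simp: visit_time_Suc Inf_enat_le_iff)
  next
    case (Suc j)
    have ret: "return_time X a S (Suc i) \<omega> =
        Inf {enat n | m n. visit_time X a S i \<omega> = enat m \<and> 1 \<le> n \<and> ?P (m + n)}"
      unfolding Suc return_time.simps visit_time_conv_sum ..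
    show ?thesis
    proof
      assume le: "visit_time X a S (Suc i) \<omega> \<le> enat t"
      obtain m k where m: "visit_time X a S i \<omega> = enat m"
        and k: "return_time X a S (Suc i) \<omega> = enat k" and "m + k \<le> t"
        using le unfolding visit_time_Suc
        by (cases "visit_time X a S i \<omega>"; cases "return_time X a S (Suc i) \<omega>") auto
      from k ret m obtain l where l: "l \<le> k" "1 \<le> l" "?P (m + l)"
        using Inf_enat_le_iff[of "{enat n | m n. visit_time X a S i \<omega> = enat m \<and> 1 \<le> n \<and> ?P (m + n)}" k]
        by auto
      have "i \<le> card (?C m)" using Suc.IH[of m] m by simp
      then have "Suc i \<le> card (insert (m + l) (?C m))" using l by simp
      also have "\<dots> \<le> card (?C t)"
        using l \<open>m + k \<le> t\<close> by (intro card_mono) auto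
      finally show "Suc i \<le> card (?C t)" .
    next
      assume ge: "Suc i \<le> card (?C t)"
      then have "visit_time X a S i \<omega> \<le> enat t" using Suc.IH[of t] by simp
      then obtain m where m: "visit_time X a S i \<omega> = enat m" and "m \<le> t"
        by (cases "visit_time X a S i \<omega>") auto
      \<comment> \<open>Fewer than \<open>i\<close> hits precede \<open>m\<close>, or the
        \<open>i\<close>-th visit would come earlier. So one of the \<open>Suc i\<close> hits up to
        \<open>t\<close> lies strictly after \<open>m\<close>.\<close>
      have "card (?C m) \<le> i"
      proof (cases m)
        case 0
        have "card (?C m) \<le> card {0::nat}" unfolding 0 by (intro card_mono) auto
        then show ?thesis using Suc by simp
      next
        case (Suc m')
        have "\<not> i \<le> card (?C m')" using Suc.IH[of m'] m Suc by simp
        moreover have "card (?C m) \<le> card (insert m (?C m'))"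
          unfolding Suc by (intro card_mono) (auto simp: le_Suc_eq)
        moreover have "card (insert m (?C m')) \<le> Suc (card (?C m'))"
          by (rule card_insert_le_m1) auto
        ultimately show ?thesis by simp
      qed
      with ge have "\<not> ?C t \<subseteq> ?C m"
        using card_mono[of "?C m" "?C t"] by auto
      then obtain s where "s \<in> ?C t" "s \<notin> ?C m" by blast
      then have s: "m < s" "s \<le> t" "?P s" by auto
      have "return_time X a S (Suc i) \<omega> \<le> enat (s - m)"
        unfolding ret using m s by (intro Inf_lower CollectI exI[of _ m] exI[of _ "s - m"]) auto
      then show "visit_time X a S (Suc i) \<omega> \<le> enat t"
        unfolding visit_time_Suc m using s by (cases "return_time X a S (Suc i) \<omega>") auto
    qed
  qed
qed

text \<open>The events \<open>A\<^sub>i\<close> of the introduction.\<close>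

definition pending ::
  "(nat \<Rightarrow> 'w \<Rightarrow> 'x) \<Rightarrow> (nat \<Rightarrow> 'w \<Rightarrow> 'c) \<Rightarrow> ('x \<times> 'c) set \<Rightarrow> nat \<Rightarrow> nat \<Rightarrow> 'w \<Rightarrow> bool"
where
  "pending X a S n i \<omega> \<longleftrightarrow>
     (if i = 0 then (X 0 \<omega>, a 0 \<omega>) \<notin> S else visit_time X a S i \<omega> \<le> enat n)"

text \<open>Index 0 is pending exactly when time 0 is no hit, which offsets the visit at time 0 that
  \<open>{1..n}\<close> leaves out.\<close>

lemma card_pending:
  "card {i. i \<le> Suc n \<and> pending X a S n i \<omega>} = Suc (card {s\<in>{1..n}. (X s \<omega>, a s \<omega>) \<in> S})"
proof -
  let ?P = "\<lambda>s. (X s \<omega>, a s \<omega>) \<in> S"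
  let ?N = "card {s. s \<le> n \<and> ?P s}"
  \<comment> \<open>Since \<open>?N \<le> n + 1\<close>, the cutoff \<open>Suc n\<close> loses no
    pending index.\<close>
  have "?N \<le> card {..n}" by (intro card_mono) auto
  then have "{i. i \<le> Suc n \<and> pending X a S n i \<omega>} = (if ?P 0 then {} else {0}) \<union> {1..?N}"
    by (auto simp: pending_def visit_time_le_iff)
  then have "card {i. i \<le> Suc n \<and> pending X a S n i \<omega>} = (if ?P 0 then 0 else 1) + ?N"
    by (simp only:) (auto simp: card_Un_disjoint)
  moreover have "{s. s \<le> n \<and> ?P s} = (if ?P 0 then {0} else {}) \<union> {s\<in>{1..n}. ?P s}"
    by (auto simp: Suc_le_eq intro: gr0I)
  then have "?N = (if ?P 0 then 1 else 0) + card {s\<in>{1..n}. ?P s}"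
    by (simp only:) (auto simp: card_Un_disjoint)
  ultimately show ?thesis by simp
qed

lemma sum_pending_return_time_ge:
  "enat n \<le> (\<Sum>i\<le>Suc n. if pending X a S n i \<omega> then return_time X a S (Suc i) \<omega> else 0)"
proof -
  let ?P = "\<lambda>s. (X s \<omega>, a s \<omega>) \<in> S"
  let ?N = "card {s. s \<le> n \<and> ?P s}"
  have N: "?N \<le> card {..n}" by (intro card_mono) auto
  have "enat n \<le> visit_time X a S (Suc ?N) \<omega>"
    using visit_time_le_iff[of X a S "Suc ?N" \<omega> n] by auto
  also have "\<dots> = (\<Sum>i<Suc ?N. return_time X a S (Suc i) \<omega>)"
    by (rule visit_time_eq_sum)
  \<comment> \<open>Only \<open>i = 0\<close> can fail to be pending here; then time 0 is a hit and
    the dropped return time is 0.\<close>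
  also have "\<dots> = (\<Sum>i<Suc ?N. if pending X a S n i \<omega> then return_time X a S (Suc i) \<omega> else 0)"
    using return_time_1_eq_0_iff[of X a S \<omega>]
    by (intro sum.cong) (auto simp: pending_def visit_time_le_iff simp del: return_time.simps)
  also have "\<dots> \<le> (\<Sum>i\<le>Suc n. if pending X a S n i \<omega> then return_time X a S (Suc i) \<omega> else 0)"
    using N by (intro sum_mono2) auto
  finally show ?thesis .
qed

section \<open>Stopping times and expectations\<close>

context controlled_markov_chain
begin

text \<open>Having at least \<open>i\<close> hits up to time \<open>k\<close> depends only on the
  process up to \<open>k\<close>, hence is an event of \<open>F k\<close>; for
  \<open>t = \<infinity>\<close> the condition is trivial.\<close>

lemma stopping_time_visit_time:
  assumes S: "S \<in> sets (restrict_space borel \<X> \<Otimes>\<^sub>M restrict_space borel \<I>)"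
  shows "stopping_time (extend_filtration M F) (visit_time X a S i)"
proof
  fix t
  show "Measurable.pred (extend_filtration M F t) (\<lambda>\<omega>. visit_time X a S i \<omega> \<le> t)"
  proof (cases t)
    case (enat k)
    have hit: "Measurable.pred (F k) (\<lambda>\<omega>. (X s \<omega>, a s \<omega>) \<in> S)" if "s \<le> k" for s
    proof -
      have "(\<lambda>\<omega>. (X s \<omega>, a s \<omega>)) \<in> F s \<rightarrow>\<^sub>M restrict_space borel \<X> \<Otimes>\<^sub>M restrict_space borel \<I>"
        using adapted_X adapted_a by (rule measurable_Pair)
      then have "Measurable.pred (F s) (\<lambda>\<omega>. (X s \<omega>, a s \<omega>) \<in> S)"
        using S by (rule pred_sets2[rotated])
      then show ?thesis
        using sets_F_mono[OF that] by (auto simp: pred_def space_F)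
    qed
    have count: "card {s. s \<le> k \<and> (X s \<omega>, a s \<omega>) \<in> S}
        = (\<Sum>s\<le>k. if (X s \<omega>, a s \<omega>) \<in> S then 1 else 0)" for \<omega>
      by (simp add: sum.If_cases Int_def)
    have "(\<lambda>\<omega>. \<Sum>s\<le>k. if (X s \<omega>, a s \<omega>) \<in> S then 1 else 0 :: nat) \<in> F k \<rightarrow>\<^sub>M count_space UNIV"
      using hit by (intro measurable_sum_nat measurable_If) (auto simp: pred_def)
    then have "Measurable.pred (F k) (\<lambda>\<omega>. i \<le> card {s. s \<le> k \<and> (X s \<omega>, a s \<omega>) \<in> S})"
      unfolding count by measurable
    then show ?thesis
      unfolding enat extend_filtration_def visit_time_le_iff enat.case .
  qed simp
qed

lemma pending_in_stopped_algebra: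
  assumes S: "S \<in> sets (restrict_space borel \<X> \<Otimes>\<^sub>M restrict_space borel \<I>)"
  shows "{\<omega>\<in>space M. pending X a S n i \<omega>} \<in> sets (stopped_algebra M F (visit_time X a S i))"
proof -
  interpret E: filtration "space M" "extend_filtration M F" by (rule filtration_extend)
  note st = stopping_time_visit_time[OF S]
  show ?thesis
    unfolding stopped_algebra_def
  proof (rule E.sets_pre_sigmaI[OF st])
    fix t
    show "{\<omega> \<in> {\<omega> \<in> space M. pending X a S n i \<omega>}. visit_time X a S i \<omega> \<le> t}
        \<in> sets (extend_filtration M F t)"
    proof (cases "i = 0")
      case True
      \<comment> \<open>Visit 0 has time 0, so the event itself must lie in every algebra; it is the
        complement of the first visit occurring at time 0.\<close>
      have "Measurable.pred (extend_filtration M F t) (\<lambda>\<omega>. visit_time X a S 1 \<omega> \<le> 0)"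
        by (rule E.stopping_time_le_const[OF st]) simp
      moreover have "visit_time X a S 1 \<omega> \<le> 0 \<longleftrightarrow> (X 0 \<omega>, a 0 \<omega>) \<in> S" for \<omega>
        using return_time_1_eq_0_iff[of X a S \<omega>] visit_time_Suc[of X a S 0 \<omega>]
        by (simp del: return_time.simps)
      ultimately have "Measurable.pred (extend_filtration M F t) (\<lambda>\<omega>. (X 0 \<omega>, a 0 \<omega>) \<notin> S)"
        by simp
      then show ?thesis
        by (simp add: True pending_def pred_def space_extend_filtration)
    next
      case False
      \<comment> \<open>The bounds \<open>n\<close> and \<open>t\<close> merge into
        \<open>min (enat n) t\<close>, which is at most \<open>t\<close>.\<close>
      have "Measurable.pred (extend_filtration M F t) (\<lambda>\<omega>. visit_time X a S i \<omega> \<le> min (enat n) t)"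
        by (rule E.stopping_time_le_const[OF st]) simp
      then show ?thesis
        by (simp add: False pending_def pred_def space_extend_filtration conj_assoc)
    qed
  qed
qed

text \<open>Return \<open>Suc i\<close> is conditioned on the algebra stopped at visit
  \<open>i\<close>, which contains the pending event. So the return time may be replaced by its
  conditional expectation under the integral and then bounded almost surely.\<close>

lemma nn_integral_pending_return_time_le:
  assumes S: "S \<in> sets (restrict_space borel \<X> \<Otimes>\<^sub>M restrict_space borel \<I>)"
  shows "(\<integral>\<^sup>+\<omega>. indicator {\<omega>\<in>space M. pending X a S n i \<omega>} \<omega>
             * ennreal_of_enat (return_time X a S (Suc i) \<omega>) \<partial>M)
         \<le> max_return_time M F X a S * emeasure M {\<omega>\<in>space M. pending X a S n i \<omega>}"
proof -
  let ?G = "stopped_algebra M F (visit_time X a S i)"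
  let ?A = "{\<omega>\<in>space M. pending X a S n i \<omega>}"
  interpret G: finite_measure_subalgebra M ?G
    by unfold_locales (rule subalgebra_stopped_algebra)
  have A: "?A \<in> sets ?G" by (rule pending_in_stopped_algebra[OF S])
  then have AM: "?A \<in> sets M"
    using subalgebra_stopped_algebra by (auto simp: subalgebra_def)
  have le: "AE \<omega> in M. cond_return_time M F X a S (Suc i) \<omega> \<le> max_return_time M F X a S"
    using max_return_time_le_iff[of M F X a S "max_return_time M F X a S"] by simp
  have "(\<integral>\<^sup>+\<omega>. indicator ?A \<omega> * ennreal_of_enat (return_time X a S (Suc i) \<omega>) \<partial>M)
      = (\<integral>\<^sup>+\<omega>. indicator ?A \<omega> * cond_return_time M F X a S (Suc i) \<omega> \<partial>M)"
    unfolding cond_return_time_def diff_Suc_1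
    using A measurable_return_time[OF S] by (intro G.nn_cond_exp_intg[symmetric]) auto
  also have "\<dots> \<le> (\<integral>\<^sup>+\<omega>. max_return_time M F X a S * indicator ?A \<omega> \<partial>M)"
    using le by (intro nn_integral_mono_AE) (auto split: split_indicator)
  also have "\<dots> = max_return_time M F X a S * emeasure M ?A"
    using AM by (rule nn_integral_cmult_indicator)
  finally show ?thesis .
qed

text \<open>Integrates the pathwise bound. The product form in \<open>ennreal\<close> also covers
  \<open>T(S) = 0\<close> and \<open>T(S) = \<infinity>\<close>.\<close>

lemma le_max_return_time_mult_occupation_freq:
  assumes S: "S \<in> sets (restrict_space borel \<X> \<Otimes>\<^sub>M restrict_space borel \<I>)" and "n \<ge> 1"
  shows "of_nat n \<le> max_return_time M F X a S * ennreal (1 + real n * occupation_freq M X a n S)"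
proof -
  let ?T = "max_return_time M F X a S"
  let ?A = "\<lambda>i. {\<omega>\<in>space M. pending X a S n i \<omega>}"
  let ?\<tau> = "\<lambda>i \<omega>. ennreal_of_enat (return_time X a S (Suc i) \<omega>)"
  let ?H = "\<lambda>s. {\<omega>\<in>space M. (X s \<omega>, a s \<omega>) \<in> S}"
  have A[measurable]: "?A i \<in> sets M" for i
    using pending_in_stopped_algebra[OF S] subalgebra_stopped_algebra
    unfolding subalgebra_def by blast
  have H[measurable]: "?H s \<in> sets M" for s
    using pred_sets2[OF S measurable_pair] by (simp add: pred_def)
  note measurable_return_time[OF S, measurable]
  have count: "(\<Sum>i\<le>Suc n. indicator (?A i) \<omega> :: ennreal) = 1 + (\<Sum>s=1..n. indicator (?H s) \<omega>)"
    if "\<omega> \<in> space M" for \<omega>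
  proof -
    have "(\<Sum>i\<le>Suc n. indicator (?A i) \<omega> :: ennreal) = of_nat (card {i. i \<le> Suc n \<and> pending X a S n i \<omega>})"
      using that by (simp add: indicator_def sum.If_cases Int_def del: sum.atMost_Suc)
    also have "\<dots> = 1 + (\<Sum>s=1..n. indicator (?H s) \<omega>)"
      unfolding card_pending using that by (simp add: indicator_def sum.If_cases Int_def)
    finally show ?thesis .
  qed
  have "of_nat n = (\<integral>\<^sup>+\<omega>. of_nat n \<partial>M)"
    by (simp add: emeasure_space_1)
  also have "\<dots> \<le> (\<integral>\<^sup>+\<omega>. (\<Sum>i\<le>Suc n. indicator (?A i) \<omega> * ?\<tau> i \<omega>) \<partial>M)"
  proof (rule nn_integral_mono)
    fix \<omega> assume "\<omega> \<in> space M"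
    then have "(\<Sum>i\<le>Suc n. indicator (?A i) \<omega> * ?\<tau> i \<omega>)
        = (\<Sum>i\<le>Suc n. ennreal_of_enat (if pending X a S n i \<omega> then return_time X a S (Suc i) \<omega> else 0))"
      by (intro sum.cong) (auto simp del: return_time.simps)
    moreover have "of_nat n \<le> ennreal_of_enat
        (\<Sum>i\<le>Suc n. if pending X a S n i \<omega> then return_time X a S (Suc i) \<omega> else 0)"
      unfolding of_nat_less_ennreal_of_nat of_nat_eq_enat by (rule sum_pending_return_time_ge)
    ultimately show "of_nat n \<le> (\<Sum>i\<le>Suc n. indicator (?A i) \<omega> * ?\<tau> i \<omega>)"
      by (simp only: sum_ennreal_of_enat)
  qed
  also have "\<dots> = (\<Sum>i\<le>Suc n. \<integral>\<^sup>+\<omega>. indicator (?A i) \<omega> * ?\<tau> i \<omega> \<partial>M)"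
    by (rule nn_integral_sum) measurable
  also have "\<dots> \<le> (\<Sum>i\<le>Suc n. ?T * emeasure M (?A i))"
    by (intro sum_mono nn_integral_pending_return_time_le[OF S])
  also have "\<dots> = ?T * (\<integral>\<^sup>+\<omega>. (\<Sum>i\<le>Suc n. indicator (?A i) \<omega>) \<partial>M)"
    by (subst nn_integral_sum) (simp_all add: sum_distrib_left del: sum.atMost_Suc)
  also have "(\<integral>\<^sup>+\<omega>. (\<Sum>i\<le>Suc n. indicator (?A i) \<omega>) \<partial>M)
      = (\<integral>\<^sup>+\<omega>. 1 + (\<Sum>s=1..n. indicator (?H s) \<omega>) \<partial>M)"
    by (intro nn_integral_cong count)
  also have "\<dots> = 1 + (\<Sum>s=1..n. emeasure M (?H s))"
    by (subst nn_integral_add, simp, measurable)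
      (subst nn_integral_sum, simp_all add: emeasure_space_1)
  also have "\<dots> = ennreal (1 + (\<Sum>s=1..n. measure M (?H s)))"
    by (simp add: emeasure_eq_measure sum_nonneg)
  also have "1 + (\<Sum>s=1..n. measure M (?H s)) = 1 + real n * occupation_freq M X a n S"
    using \<open>n \<ge> 1\<close> by (simp add: occupation_freq_def)
  finally show ?thesis .
qed

end

theorem lemma25:
  fixes M :: "'w measure" and F :: "nat \<Rightarrow> 'w measure"
    and \<X> :: "(real ^ 'd1) set" and \<I> :: "(real ^ 'd2) set"
    and X :: "nat \<Rightarrow> 'w \<Rightarrow> real ^ 'd1" and a :: "nat \<Rightarrow> 'w \<Rightarrow> real ^ 'd2"
    and S :: "((real ^ 'd1) \<times> (real ^ 'd2)) set" and n :: nat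
  assumes "controlled_markov_chain M F \<X> \<I> X a"
    and "S \<in> sets (restrict_space borel \<X> \<Otimes>\<^sub>M restrict_space borel \<I>)"
    and "n \<ge> 1"
  shows "ereal (occupation_freq M X a n S)
           \<ge> 1 / enn2ereal (max_return_time M F X a S) - 1 / ereal (real n)"
proof -
  interpret controlled_markov_chain M F \<X> \<I> X a by fact
  let ?T = "max_return_time M F X a S"
  let ?\<nu> = "occupation_freq M X a n S"
  have le: "of_nat n \<le> ?T * ennreal (1 + real n * ?\<nu>)"
    using assms(2,3) by (rule le_max_return_time_mult_occupation_freq)
  have \<nu>: "0 \<le> ?\<nu>" by (simp add: occupation_freq_def sum_nonneg)
  have n: "real n > 0" using assms(3) by simp
  show ?thesis
  proof (cases ?T)
    case (real t)
    have "ennreal (real n) \<le> ennreal (t * (1 + real n * ?\<nu>))"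
      using le real \<nu> by (simp add: ennreal_mult ennreal_of_nat_eq_real_of_nat)
    then have *: "real n \<le> t * (1 + real n * ?\<nu>)"
      using real \<nu> by (subst (asm) ennreal_le_iff) auto
    \<comment> \<open>In \<open>ereal\<close>, \<open>1 / 0\<close> is \<open>\<infinity>\<close>,
      so \<open>T(S) = 0\<close> has to be excluded; \<open>n \<ge> 1\<close> does this.\<close>
    then have "t \<noteq> 0" using n by auto
    then have "t > 0" using real by simp
    then have "1 / t - 1 / real n \<le> ?\<nu>"
      using * n by (simp add: field_simps)
    then show ?thesis
      using real \<open>t > 0\<close> n by (simp add: one_ereal_def)
  next
    case top
    \<comment> \<open>With \<open>1 / \<infinity> = 0\<close> the lower bound is negative.\<close>
    have "- (1 / real n) \<le> ?\<nu>" by (rule order_trans[OF _ \<nu>]) simp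
    then show ?thesis using top n by (simp add: one_ereal_def)
  qed
qed

end
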